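(* Let $G$ be a countable weakly branch group acting on a spherically homogeneous rooted tree $T$. Then for any $x,y\in\partial T$ such that the orbits $Gx$ and $Gy$ are disjoint, the quasi-regular representations $\rho_x$ and $\rho_y$ of $G$ are not unitarily equivalent.
   Context: A rooted tree is an infinite tree $T$ with vertex set divided into levels $V_n$, $n\in\mathbb{Z}_{\geq 0}$, such that $V_0=\{v_0\}$ consists of one vertex (the root), edges join only consecutive levels, and each vertex of $V_n$ ($n\geq 1$) is joined to exactly one vertex of $V_{n-1}$. $T$ is spherically homogeneous if, for each $n$, every vertex of $V_n$ is joined to the same finite number $d_n\geq 1$ of vertices of $V_{n+1}$. $\mathrm{Aut}(T)$ is the group of graph automorphisms of $T$ fixing the root. The boundary $\partial T$ is the set of infinite paths starting at $v_0$ and passing through each level exactly once; $\mathrm{Aut}(T)$ acts naturally on it. For a vertex $v$, $T_v$ is the subtree emerging from $v$ (all descendants of $v$, including $v$). A subgroup $G<\mathrm{Aut}(T)$ is weakly branch if it acts transitively on each level $V_n$ and, for every vertex $v$, the rigid stabilizer $\mathrm{rist}_v(G)$, i.e. the subgroup of all $g\in G$ fixing every vertex outside $T_v$, is nontrivial. For $x\in\partial T$, the quasi-regular representation $\rho_x$ is the unitary representation of $G$ in $l^2(Gx)$, where $Gx$ is the orbit of $x$ (a countable discrete set), given by $(\rho_x(g)f)(y)=f(g^{-1}y)$. *)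

theory Defs
  imports
    "HOL-Algebra.Group"
    "HOL-Analysis.Infinite_Sum"
    "HOL-Combinatorics.Permutations"
    "HOL-Library.Countable_Set"
begin

record 'v levelled_graph =
  root :: 'v
  level :: "nat \<Rightarrow> 'v set"
  edges :: "'v set set"

definition verts :: "'v levelled_graph \<Rightarrow> 'v set"
  where "verts T = (\<Union>n. level T n)"

definition children :: "'v levelled_graph \<Rightarrow> nat \<Rightarrow> 'v \<Rightarrow> 'v set"
  where "children T n v = {w \<in> level T (Suc n). {v, w} \<in> edges T}"

definition rooted_tree :: "'v levelled_graph \<Rightarrow> bool"
  where "rooted_tree T \<longleftrightarrow>
    infinite (verts T) \<and>
    disjoint_family (level T) \<and>
    level T 0 = {root T} \<and>
    (\<forall>e\<in>edges T. \<exists>n. \<exists>u\<in>level T n. \<exists>v\<in>level T (Suc n). e = {u, v}) \<and>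
    (\<forall>n. \<forall>v\<in>level T (Suc n). \<exists>!u. u \<in> level T n \<and> {u, v} \<in> edges T)"

definition spherically_homogeneous :: "'v levelled_graph \<Rightarrow> bool"
  where "spherically_homogeneous T \<longleftrightarrow>
    (\<exists>d::nat \<Rightarrow> nat. \<forall>n. d n \<ge> 1 \<and>
      (\<forall>v\<in>level T n. finite (children T n v) \<and> card (children T n v) = d n))"

text \<open>
  The vertex set of \<open>T\<close> is only a subset of the type, so automorphisms are taken to be the
  identity off it (this is part of \<open>permutes\<close>); in this way distinct functions are
  distinct automorphisms.
\<close>

definition Aut :: "'v levelled_graph \<Rightarrow> ('v \<Rightarrow> 'v) set"
  where "Aut T = {g. g permutes verts T \<and> g (root T) = root T \<and>
    (\<forall>u\<in>verts T. \<forall>v\<in>verts T. {g u, g v} \<in> edges T \<longleftrightarrow> {u, v} \<in> edges T)}"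

definition Aut_group :: "'v levelled_graph \<Rightarrow> ('v \<Rightarrow> 'v) monoid"
  where "Aut_group T = \<lparr>carrier = Aut T, monoid.mult = (\<circ>), one = id\<rparr>"

definition boundary :: "'v levelled_graph \<Rightarrow> (nat \<Rightarrow> 'v) set"
  where "boundary T = {p. p 0 = root T \<and> (\<forall>k. {p k, p (Suc k)} \<in> edges T) \<and>
    (\<forall>n. \<exists>!k. p k \<in> level T n)}"

definition subtree :: "'v levelled_graph \<Rightarrow> 'v \<Rightarrow> 'v set"
  where "subtree T v = {u. (v, u) \<in> {(a, b). \<exists>n. a \<in> level T n \<and> b \<in> children T n a}\<^sup>*}"

definition rist :: "'v levelled_graph \<Rightarrow> ('v \<Rightarrow> 'v) set \<Rightarrow> 'v \<Rightarrow> ('v \<Rightarrow> 'v) set"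
  where "rist T G v = {g \<in> G. \<forall>u\<in>verts T - subtree T v. g u = u}"

definition weakly_branch :: "'v levelled_graph \<Rightarrow> ('v \<Rightarrow> 'v) set \<Rightarrow> bool"
  where "weakly_branch T G \<longleftrightarrow>
    subgroup G (Aut_group T) \<and>
    (\<forall>n. \<forall>u\<in>level T n. \<forall>w\<in>level T n. \<exists>g\<in>G. g u = w) \<and>
    (\<forall>v\<in>verts T. rist T G v \<noteq> {id})"

text \<open>An automorphism \<open>g\<close> sends a path \<open>p\<close> to \<open>g \<circ> p\<close>.\<close>

definition bd_orbit :: "('v \<Rightarrow> 'v) set \<Rightarrow> (nat \<Rightarrow> 'v) \<Rightarrow> (nat \<Rightarrow> 'v) set"
  where "bd_orbit G x = (\<lambda>g. g \<circ> x) ` G"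

text \<open>
  Elements of \<open>l\<^sup>2(A)\<close> are represented by functions on the whole type that vanish
  off \<open>A\<close>; the vector space operations are pointwise.
\<close>

definition l2 :: "'b set \<Rightarrow> ('b \<Rightarrow> complex) set"
  where "l2 A = {f. (\<forall>z. z \<notin> A \<longrightarrow> f z = 0) \<and> (\<lambda>z. (cmod (f z))\<^sup>2) summable_on A}"

definition l2_inner :: "'b set \<Rightarrow> ('b \<Rightarrow> complex) \<Rightarrow> ('b \<Rightarrow> complex) \<Rightarrow> complex"
  where "l2_inner A f h = (\<Sum>\<^sub>\<infinity>z\<in>A. f z * cnj (h z))"

definition unitary_map ::
    "'b set \<Rightarrow> 'c set \<Rightarrow> (('b \<Rightarrow> complex) \<Rightarrow> ('c \<Rightarrow> complex)) \<Rightarrow> bool"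
  where "unitary_map A B U \<longleftrightarrow>
    bij_betw U (l2 A) (l2 B) \<and>
    (\<forall>f\<in>l2 A. \<forall>h\<in>l2 A. U (\<lambda>z. f z + h z) = (\<lambda>z. U f z + U h z)) \<and>
    (\<forall>c. \<forall>f\<in>l2 A. U (\<lambda>z. c * f z) = (\<lambda>z. c * U f z)) \<and>
    (\<forall>f\<in>l2 A. \<forall>h\<in>l2 A. l2_inner B (U f) (U h) = l2_inner A f h)"

text \<open>
  Unitary equivalence of a representation \<open>\<rho>\<close> of \<open>G\<close> in \<open>l\<^sup>2(A)\<close> and a representation
  \<open>\<sigma>\<close> of \<open>G\<close> in \<open>l\<^sup>2(B)\<close>.
\<close>

definition unitarily_equivalent ::
    "'g set \<Rightarrow> 'b set \<Rightarrow> ('g \<Rightarrow> ('b \<Rightarrow> complex) \<Rightarrow> ('b \<Rightarrow> complex)) \<Rightarrow>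
     'c set \<Rightarrow> ('g \<Rightarrow> ('c \<Rightarrow> complex) \<Rightarrow> ('c \<Rightarrow> complex)) \<Rightarrow> bool"
  where "unitarily_equivalent G A \<rho> B \<sigma> \<longleftrightarrow>
    (\<exists>U. unitary_map A B U \<and> (\<forall>g\<in>G. \<forall>f\<in>l2 A. U (\<rho> g f) = \<sigma> g (U f)))"

definition quasi_regular ::
    "('v \<Rightarrow> 'v) set \<Rightarrow> (nat \<Rightarrow> 'v) \<Rightarrow> ('v \<Rightarrow> 'v) \<Rightarrow>
     ((nat \<Rightarrow> 'v) \<Rightarrow> complex) \<Rightarrow> ((nat \<Rightarrow> 'v) \<Rightarrow> complex)"
  where "quasi_regular G x g f =
    (\<lambda>y. if y \<in> bd_orbit G x then f (inv_into UNIV g \<circ> y) else 0)"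

lemma group_Aut_group: "group (Aut_group T)"
proof (rule groupI)
  fix g assume "g \<in> carrier (Aut_group T)"
  then have g: "g permutes verts T" "g (root T) = root T"
    "\<And>u v. u \<in> verts T \<Longrightarrow> v \<in> verts T \<Longrightarrow> {g u, g v} \<in> edges T \<longleftrightarrow> {u, v} \<in> edges T"
    by (auto simp: Aut_group_def Aut_def)
  let ?h = "inv_into UNIV g"
  have h: "?h permutes verts T" by (rule permutes_inv[OF g(1)])
  have gh: "g (?h u) = u" for u using permutes_inverses(1)[OF g(1)] .
  have "?h (root T) = root T" using g(1,2) by (metis permutes_inverses(2))
  moreover have "{?h u, ?h v} \<in> edges T \<longleftrightarrow> {u, v} \<in> edges T"
    if "u \<in> verts T" "v \<in> verts T" for u v
    using g(3)[of "?h u" "?h v"] that permutes_in_image[OF h] by (simp add: gh)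
  ultimately have "?h \<in> carrier (Aut_group T)"
    using h by (auto simp: Aut_group_def Aut_def)
  moreover have "?h \<circ> g = id" using permutes_inv_o(2)[OF g(1)] .
  ultimately show "\<exists>h\<in>carrier (Aut_group T). h \<otimes>\<^bsub>Aut_group T\<^esub> g = \<one>\<^bsub>Aut_group T\<^esub>"
    by (intro bexI[of _ ?h]) (auto simp: Aut_group_def)
qed (auto simp: Aut_group_def Aut_def permutes_compose permutes_id permutes_in_image comp_assoc)

end

(*
  If U intertwines the two representations, then U \<delta>\<^sub>x is a nonzero square-summable function on
  Gy that is invariant under the stabilizer of x, so some orbit of that stabilizer on Gy is finite.
  But every z \<noteq> x has an infinite orbit: for all large m the rigid stabilizer of the vertex z m
  fixes x, and it contains an element moving z (conjugate any nontrivial element so that the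
  vertex it moves lies on z), whose effect on z is invisible above level m.
*)

theory Submission imports Defs begin

section \<open>Levels, subtrees and boundary paths\<close>

lemma level_eqD:
  assumes T: "rooted_tree T" and "v \<in> level T m" "v \<in> level T n"
  shows "m = n"
proof -
  have "disjoint_family (level T)" using T by (simp add: rooted_tree_def)
  then show ?thesis using assms(2,3) by (auto simp: disjoint_family_on_def)
qed

lemma parent_unique:
  assumes T: "rooted_tree T" and "v \<in> level T (Suc n)"
    and "u \<in> level T n" "{u, v} \<in> edges T" "u' \<in> level T n" "{u', v} \<in> edges T"
  shows "u = u'"
proof -
  have "\<exists>!u. u \<in> level T n \<and> {u, v} \<in> edges T"
    using T assms(2) by (simp add: rooted_tree_def)
  then show ?thesis using assms(3-6) by blast
qed

lemma parent_exists:
  assumes T: "rooted_tree T" and "v \<in> level T (Suc n)"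
  obtains u where "u \<in> level T n" "{u, v} \<in> edges T"
proof -
  have "\<exists>!u. u \<in> level T n \<and> {u, v} \<in> edges T"
    using T assms(2) by (simp add: rooted_tree_def)
  then show thesis using that by blast
qed

lemma level_adjacent:
  assumes T: "rooted_tree T" and e: "{u, v} \<in> edges T" and u: "u \<in> level T n"
  shows "v \<in> level T (Suc n) \<or> (\<exists>m. n = Suc m \<and> v \<in> level T m)"
proof -
  have "\<forall>e\<in>edges T. \<exists>n. \<exists>u\<in>level T n. \<exists>v\<in>level T (Suc n). e = {u, v}"
    using T by (simp add: rooted_tree_def)
  from bspec[OF this e] obtain k a b where
    ab: "a \<in> level T k" "b \<in> level T (Suc k)" "{u, v} = {a, b}"
    by blast
  then consider "u = a" "v = b" | "u = b" "v = a" by (auto simp: doubleton_eq_iff)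
  then show ?thesis
  proof cases
    case 1
    then show ?thesis using ab(1,2) level_eqD[OF T u] by blast
  next
    case 2
    then show ?thesis using ab(1,2) level_eqD[OF T u] by blast
  qed
qed

text \<open>The definition of \<open>boundary\<close> does not prescribe the order in which levels
  are met. Every edge changes the level by one, and a step back towards the root would meet an
  already visited level a second time.\<close>

lemma boundary_level:
  assumes T: "rooted_tree T" and p: "p \<in> boundary T"
  shows "p n \<in> level T n"
proof (induction n rule: less_induct)
  case (less n)
  show ?case
  proof (cases n)
    case 0
    then show ?thesis using T p by (simp add: boundary_def rooted_tree_def)
  next
    case (Suc k)
    have "{p k, p (Suc k)} \<in> edges T" using p by (simp add: boundary_def)
    moreover have "p (Suc k) \<notin> level T m" if "k = Suc m" for m
    proof
      assume "p (Suc k) \<in> level T m"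
      moreover have "p m \<in> level T m" using less that Suc by simp
      ultimately have "Suc k = m" using p by (auto simp: boundary_def)
      then show False using that by simp
    qed
    ultimately show ?thesis
      using level_adjacent[OF T _ less[of k]] Suc by auto
  qed
qed

lemma boundaryI:
  assumes T: "rooted_tree T" and "\<And>n. p n \<in> level T n" "\<And>n. {p n, p (Suc n)} \<in> edges T"
  shows "p \<in> boundary T"
proof -
  have "p 0 = root T" using assms(2)[of 0] T by (simp add: rooted_tree_def)
  moreover have "\<exists>!k. p k \<in> level T n" for n
    using assms(2) level_eqD[OF T] by (intro ex1I[of _ n]) blast+
  ultimately show ?thesis using assms(3) by (simp add: boundary_def)
qed

lemma level_subset_verts: "v \<in> level T n \<Longrightarrow> v \<in> verts T"
  by (auto simp: verts_def)

text \<open>Parents are unique, so a chain of descendants ending at \<open>p k\<close>, read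
  backwards, has to run along \<open>p\<close> itself.\<close>

lemma subtree_root_on_boundary:
  assumes T: "rooted_tree T" and p: "p \<in> boundary T"
    and "p k \<in> subtree T v" "v \<in> level T m"
  shows "m \<le> k \<and> v = p m"
proof -
  let ?R = "{(a, b). \<exists>n. a \<in> level T n \<and> b \<in> children T n a}"
  have "(v, u) \<in> ?R\<^sup>* \<Longrightarrow> u = p k \<Longrightarrow> m \<le> k \<and> v = p m" for u
  proof (induction arbitrary: k rule: rtrancl_induct)
    case base
    then show ?case
      using level_eqD[OF T assms(4)] boundary_level[OF T p, of k] by auto
  next
    case (step a b)
    then obtain n where n: "a \<in> level T n" "b \<in> level T (Suc n)" "{a, b} \<in> edges T"
      by (auto simp: children_def)
    have k: "k = Suc n"
      using level_eqD[OF T n(2)] boundary_level[OF T p, of k] step.prems by simp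
    have "{p n, b} \<in> edges T" using p k step.prems by (simp add: boundary_def)
    then have "a = p n"
      using parent_unique[OF T n(2)] n boundary_level[OF T p] by blast
    then show ?case using step.IH k le_Suc_eq by blast
  qed
  then show ?thesis using assms(3) by (simp add: subtree_def)
qed

text \<open>Two paths that have separated cannot meet again, since a common vertex would have two
  parents.\<close>

lemma boundary_neq_mono:
  assumes T: "rooted_tree T" and "p \<in> boundary T" "q \<in> boundary T"
    and "p n \<noteq> q n" "n \<le> m"
  shows "p m \<noteq> q m"
  using assms(5)
proof (induction rule: dec_induct)
  case (step k)
  show ?case
  proof
    assume "p (Suc k) = q (Suc k)"
    moreover have "{p k, p (Suc k)} \<in> edges T" "{q k, q (Suc k)} \<in> edges T"
      using assms(2,3) by (simp_all add: boundary_def)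
    ultimately show False
      using parent_unique[OF T boundary_level[OF T assms(2)]] boundary_level[OF T] assms(2,3)
        step.IH by metis
  qed
qed (rule assms(4))

section \<open>Automorphisms\<close>

lemma Aut_edge:
  assumes "g \<in> Aut T" "{a, b} \<in> edges T" "a \<in> verts T" "b \<in> verts T"
  shows "{g a, g b} \<in> edges T"
  using assms by (simp add: Aut_def)

text \<open>\<open>Aut\<close> mentions only the root and the edges; levels are recovered by
  induction. The image of a child \<open>v\<close> of \<open>u\<close> is adjacent to
  \<open>g u\<close>. If it lay above \<open>g u\<close>, it would be the parent of
  \<open>g u\<close>, which is already the image of the parent of \<open>u\<close>, contrary to
  injectivity.\<close>

lemma Aut_level:
  assumes T: "rooted_tree T" and g: "g \<in> Aut T" and "v \<in> level T n"
  shows "g v \<in> level T n"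
  using assms(3)
proof (induction n arbitrary: v rule: less_induct)
  case (less n)
  have inj: "inj g" using g permutes_inj by (auto simp: Aut_def)
  have edge: "{g a, g b} \<in> edges T" if "{a, b} \<in> edges T" "a \<in> level T i" "b \<in> level T j" for a b i j
    using Aut_edge[OF g that(1) level_subset_verts[OF that(2)] level_subset_verts[OF that(3)]] .
  show ?case
  proof (cases n)
    case 0
    have "level T 0 = {root T}" using T by (simp add: rooted_tree_def)
    then show ?thesis using g less.prems 0 by (simp add: Aut_def)
  next
    case (Suc k)
    obtain u where u: "u \<in> level T k" "{u, v} \<in> edges T"
      using parent_exists[OF T, of v k] less.prems Suc by blast
    have gu: "g u \<in> level T k" using less.IH[OF _ u(1)] Suc by simp
    have "g v \<notin> level T m" if k: "k = Suc m" for m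
    proof
      assume gv: "g v \<in> level T m"
      obtain w where w: "w \<in> level T m" "{w, u} \<in> edges T"
        using parent_exists[OF T, of u m] u(1) k by blast
      have "g w \<in> level T m" using less.IH[OF _ w(1)] Suc k by simp
      moreover have "{g w, g u} \<in> edges T" "{g v, g u} \<in> edges T"
        using edge[OF w(2) w(1) u(1)] edge[OF u(2) u(1) less.prems]
        by (simp_all add: insert_commute)
      ultimately have "g w = g v"
        using parent_unique[OF T _ _ _ gv] gu unfolding k by blast
      then have "w = v" using inj by (simp add: inj_eq)
      then show False using level_eqD[OF T w(1), of n] less.prems Suc k by simp
    qed
    then show ?thesis
      using level_adjacent[OF T edge[OF u(2) u(1) less.prems] gu] Suc by auto
  qed
qed

lemma Aut_boundary:
  assumes T: "rooted_tree T" and g: "g \<in> Aut T" and p: "p \<in> boundary T"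
  shows "g \<circ> p \<in> boundary T"
proof (rule boundaryI[OF T])
  show "(g \<circ> p) n \<in> level T n" for n
    using Aut_level[OF T g] boundary_level[OF T p] by simp
  have "p n \<in> verts T" for n using boundary_level[OF T p] by (rule level_subset_verts)
  then show "{(g \<circ> p) n, (g \<circ> p) (Suc n)} \<in> edges T" for n
    using p Aut_edge[OF g] by (simp add: boundary_def)
qed

lemma Aut_subtree:
  assumes T: "rooted_tree T" and g: "g \<in> Aut T" and "u \<in> subtree T v"
  shows "g u \<in> subtree T (g v)"
proof -
  let ?R = "{(a, b). \<exists>n. a \<in> level T n \<and> b \<in> children T n a}"
  have "(v, u) \<in> ?R\<^sup>* \<Longrightarrow> (g v, g u) \<in> ?R\<^sup>*"
  proof (induction rule: rtrancl_induct)
    case (step a b)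
    then obtain n where n: "a \<in> level T n" "b \<in> level T (Suc n)" "{a, b} \<in> edges T"
      by (auto simp: children_def)
    then have "{g a, g b} \<in> edges T"
      using Aut_edge[OF g] level_subset_verts by metis
    then have "(g a, g b) \<in> ?R"
      using n Aut_level[OF T g] by (auto simp: children_def)
    then show ?case using step.IH by (rule rtrancl_into_rtrancl[rotated])
  qed simp
  then show ?thesis using assms(3) by (simp add: subtree_def)
qed

text \<open>A path that misses \<open>v\<close> at the level of \<open>v\<close> never enters the
  subtree of \<open>v\<close>.\<close>

lemma rist_fixes_boundary_point:
  assumes T: "rooted_tree T" and p: "p \<in> boundary T" and "v \<in> level T m" "v \<noteq> p m"
    and g: "g \<in> rist T G v"
  shows "g \<circ> p = p"
proof
  fix j
  have "p j \<notin> subtree T v" using subtree_root_on_boundary[OF T p] assms(3,4) by blast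
  then show "(g \<circ> p) j = p j"
    using g level_subset_verts[OF boundary_level[OF T p]] by (auto simp: rist_def)
qed

lemma rist_fixes_initial_segment:
  assumes T: "rooted_tree T" and p: "p \<in> boundary T" and g: "g \<in> rist T G (p m)" and "j < m"
  shows "g (p j) = p j"
proof -
  have "p j \<notin> subtree T (p m)"
    using subtree_root_on_boundary[OF T p _ boundary_level[OF T p]] assms(4) by fastforce
  then show ?thesis
    using g level_subset_verts[OF boundary_level[OF T p]] by (auto simp: rist_def)
qed

section \<open>Weakly branch groups\<close>

context
  fixes T :: "'v levelled_graph" and G :: "('v \<Rightarrow> 'v) set"
  assumes T: "rooted_tree T" and wb: "weakly_branch T G"
begin

lemma subgroup_Aut: "subgroup G (Aut_group T)"
  using wb by (simp add: weakly_branch_def)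

lemma G_Aut: "g \<in> G \<Longrightarrow> g \<in> Aut T"
  using subgroup.subset[OF subgroup_Aut] by (auto simp: Aut_group_def)

lemma G_bij: "g \<in> G \<Longrightarrow> bij g"
  by (drule G_Aut) (auto simp: Aut_def intro: permutes_bij)

lemma G_id: "id \<in> G"
  using subgroup.one_closed[OF subgroup_Aut] by (simp add: Aut_group_def)

lemma G_comp: "g \<in> G \<Longrightarrow> h \<in> G \<Longrightarrow> g \<circ> h \<in> G"
  using subgroup.m_closed[OF subgroup_Aut] by (simp add: Aut_group_def)

text \<open>Links the inverse of the abstract group to the functional inverse that occurs in
  \<open>quasi_regular\<close>.\<close>

lemma G_inv:
  assumes g: "g \<in> G"
  shows "inv_into UNIV g \<in> G"
proof -
  let ?h = "m_inv (Aut_group T) g"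
  have "?h \<in> G" using subgroup.m_inv_closed[OF subgroup_Aut g] .
  moreover have "?h \<circ> g = id"
    using group.l_inv[OF group_Aut_group, of g T] G_Aut[OF g] by (simp add: Aut_group_def)
  then have "?h = inv_into UNIV g"
    using G_bij[OF g] by (metis bij_is_surj comp_assoc comp_id id_comp surj_iff)
  ultimately show ?thesis by simp
qed

text \<open>A nontrivial element of the rigid stabilizer may move only vertices that are not on
  \<open>z\<close>. Level transitivity allows it to be conjugated so that a moved vertex is carried
  onto \<open>z\<close>.\<close>

lemma rist_moves_boundary_point:
  assumes z: "z \<in> boundary T"
  obtains g where "g \<in> rist T G (z m)" "g \<circ> z \<noteq> z"
proof -
  have zv: "z m \<in> verts T" using level_subset_verts[OF boundary_level[OF T z]] .
  have "id \<in> rist T G (z m)" using G_id by (simp add: rist_def)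
  moreover have "rist T G (z m) \<noteq> {id}" using wb zv by (simp add: weakly_branch_def)
  ultimately obtain g where g: "g \<in> rist T G (z m)" "g \<noteq> id" by blast
  then have gG: "g \<in> G" by (simp add: rist_def)
  from g(2) obtain w where w: "g w \<noteq> w" by fastforce
  have "w \<in> verts T"
    using w G_Aut[OF gG] permutes_not_in[of g "verts T" w] by (auto simp: Aut_def)
  moreover from this have w_sub: "w \<in> subtree T (z m)" using w g(1) by (auto simp: rist_def)
  ultimately obtain k where k: "w \<in> level T k" by (auto simp: verts_def)
  then obtain h where h: "h \<in> G" "h w = z k"
    using wb boundary_level[OF T z, of k] unfolding weakly_branch_def by blast
  note hA = G_Aut[OF h(1)] and hb = G_bij[OF h(1)]
  have inv_h: "inv_into UNIV h (h u) = u" "h (inv_into UNIV h u) = u" for u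
    using hb by (simp_all add: bij_is_inj bij_is_surj surj_f_inv_f)
  \<comment> \<open>\<open>h (z m)\<close> has level \<open>m\<close> and has
    \<open>z k = h w\<close> as a descendant, so it lies on \<open>z\<close>. Hence conjugation by
    \<open>h\<close> keeps the support inside the subtree of \<open>z m\<close>.\<close>
  have hz: "h (z m) = z m"
    using subtree_root_on_boundary[OF T z, of k "h (z m)" m] Aut_subtree[OF T hA w_sub] h(2)
      Aut_level[OF T hA boundary_level[OF T z]] by simp
  let ?g = "h \<circ> g \<circ> inv_into UNIV h"
  have "?g u = u" if u: "u \<in> verts T - subtree T (z m)" for u
  proof -
    have "inv_into UNIV h u \<in> verts T"
      using u Aut_level[OF T G_Aut[OF G_inv[OF h(1)]]] by (auto simp: verts_def)
    moreover have "inv_into UNIV h u \<notin> subtree T (z m)"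
      using Aut_subtree[OF T hA, of "inv_into UNIV h u" "z m"] u by (auto simp: hz inv_h)
    ultimately show ?thesis using g(1) by (simp add: rist_def inv_h)
  qed
  then have "?g \<in> rist T G (z m)"
    using h(1) gG G_comp G_inv by (simp add: rist_def)
  \<comment> \<open>The conjugate sends \<open>z k = h w\<close> to \<open>h (g w)\<close>, and
    \<open>h\<close> is injective.\<close>
  moreover have "?g (z k) \<noteq> z k"
    using w inv_h h(2) by (metis comp_apply)
  then have "?g \<circ> z \<noteq> z" by (metis comp_apply)
  ultimately show thesis by (rule that)
qed

lemma infinite_stabilizer_orbit:
  assumes x: "x \<in> boundary T" and z: "z \<in> boundary T" and "z \<noteq> x"
  shows "infinite ((\<lambda>g. g \<circ> z) ` {g \<in> G. g \<circ> x = x})" (is "infinite ?S")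
proof
  assume fin: "finite ?S"
  obtain n where n: "z n \<noteq> x n" using assms(3) by fastforce
  \<comment> \<open>\<open>K w\<close> is an index witnessing that \<open>w\<close> differs from
    \<open>z\<close>. Its value at \<open>z\<close> itself is arbitrary; it can only enlarge
    \<open>M\<close>.\<close>
  define K where "K w = (SOME k. w k \<noteq> z k)" for w
  have K: "w (K w) \<noteq> z (K w)" if "w \<noteq> z" for w
    unfolding K_def by (rule someI_ex) (use that in \<open>simp add: fun_eq_iff\<close>)
  \<comment> \<open>Including \<open>n\<close> ensures \<open>z M \<noteq> x M\<close>, so that the
    rigid stabilizer of \<open>z M\<close> fixes \<open>x\<close>. The successor puts every witness
    \<open>K w\<close> strictly above the subtree of \<open>z M\<close>.\<close>
  define M where "M = Suc (Max (insert n (K ` ?S)))"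
  have fin': "finite (insert n (K ` ?S))" using fin by simp
  have M: "K w < M" if "w \<in> ?S" for w
    unfolding M_def by (intro le_imp_less_Suc Max_ge[OF fin'] insertI2 imageI that)
  have "n \<le> M"
    unfolding M_def by (intro le_SucI Max_ge[OF fin'] insertI1)
  obtain g where g: "g \<in> rist T G (z M)" "g \<circ> z \<noteq> z"
    using rist_moves_boundary_point[OF z] .
  have "g \<circ> x = x"
    using rist_fixes_boundary_point[OF T x boundary_level[OF T z] _ g(1)]
      boundary_neq_mono[OF T z x n \<open>n \<le> M\<close>] by blast
  moreover have "g \<in> G" using g(1) by (simp add: rist_def)
  ultimately have gz: "g \<circ> z \<in> ?S" by blast
  \<comment> \<open>\<open>g \<circ> z\<close> belongs to the orbit and differs from
    \<open>z\<close> at an index below \<open>M\<close>, where \<open>g\<close> fixes the vertices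
    of \<open>z\<close>.\<close>
  show False
    using K[OF g(2)] rist_fixes_initial_segment[OF T z g(1) M[OF gz]] by simp
qed

end

section \<open>Square-summable functions\<close>

text \<open>A nonzero constant is not summable over an infinite set.\<close>

lemma l2_zero_of_constant_on_infinite:
  assumes f: "f \<in> l2 A" and "S \<subseteq> A" "infinite S" and const: "\<And>z. z \<in> S \<Longrightarrow> f z = c"
  shows "c = 0"
proof -
  have "(\<lambda>z. (cmod (f z))\<^sup>2) summable_on S"
    using f assms(2) summable_on_subset_banach by (fastforce simp: l2_def)
  then have "(\<lambda>_. (cmod c)\<^sup>2) summable_on S"
    using const by (simp cong: summable_on_cong)
  then show ?thesis
    using infsum_diverge_constant[of S "(cmod c)\<^sup>2"] assms(3) by auto
qed

lemma delta_in_l2: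
  assumes "x \<in> A"
  shows "(\<lambda>z. if z = x then 1 else 0) \<in> l2 A"
    and "l2_inner A (\<lambda>z. if z = x then 1 else 0) (\<lambda>z. if z = x then 1 else 0) = 1"
proof -
  have "(\<lambda>z. (cmod (if z = x then 1 else 0))\<^sup>2) summable_on A
      \<longleftrightarrow> (\<lambda>z. (cmod (if z = x then 1 else 0))\<^sup>2) summable_on {x}"
    using assms by (intro summable_on_cong_neutral) auto
  then show "(\<lambda>z. if z = x then 1 else 0) \<in> l2 A"
    using assms by (auto simp: l2_def)
  have "l2_inner A (\<lambda>z. if z = x then 1 else 0) (\<lambda>z. if z = x then 1 else 0)
      = (\<Sum>\<^sub>\<infinity>z\<in>{x}. 1)"
    unfolding l2_inner_def using assms by (intro infsum_cong_neutral) auto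
  then show "l2_inner A (\<lambda>z. if z = x then 1 else 0) (\<lambda>z. if z = x then 1 else 0) = 1"
    by simp
qed

theorem theorem1:
  fixes T :: "'v levelled_graph" and G :: "('v \<Rightarrow> 'v) set" and x y :: "nat \<Rightarrow> 'v"
  assumes "rooted_tree T" and "spherically_homogeneous T"
    and "weakly_branch T G" and "countable G"
    and "x \<in> boundary T" and "y \<in> boundary T"
    and "bd_orbit G x \<inter> bd_orbit G y = {}"
  shows "\<not> unitarily_equivalent G
           (bd_orbit G x) (quasi_regular G x)
           (bd_orbit G y) (quasi_regular G y)"
proof
  let ?A = "bd_orbit G x" and ?B = "bd_orbit G y"
  let ?\<delta> = "\<lambda>z. if z = x then 1 else 0 :: complex"
  assume "unitarily_equivalent G ?A (quasi_regular G x) ?B (quasi_regular G y)"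
  then obtain U where U: "unitary_map ?A ?B U"
    and comm: "\<And>g f. g \<in> G \<Longrightarrow> f \<in> l2 ?A \<Longrightarrow> U (quasi_regular G x g f) = quasi_regular G y g (U f)"
    unfolding unitarily_equivalent_def by blast
  note T = assms(1) and wb = assms(3)
  have xA: "x \<in> ?A" unfolding bd_orbit_def
    using G_id[OF T wb] by (intro image_eqI[of _ _ id]) simp_all
  note \<delta> = delta_in_l2[OF xA]
  have \<eta>: "U ?\<delta> \<in> l2 ?B" using U \<delta>(1) by (auto simp: unitary_map_def bij_betw_def)
  have inv_comp: "inv_into UNIV g \<circ> (g \<circ> p) = p" "g \<circ> (inv_into UNIV g \<circ> p) = p" if "g \<in> G" for g and p :: "nat \<Rightarrow> 'v"
    using G_bij[OF T wb that]
    by (auto simp: fun_eq_iff bij_is_inj bij_is_surj surj_f_inv_f)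
  have orbit_closed: "g \<circ> z \<in> ?B" if g: "g \<in> G" and z: "z \<in> ?B" for g z
  proof -
    obtain h where "h \<in> G" "z = h \<circ> y" using z by (auto simp only: bd_orbit_def)
    then show ?thesis
      unfolding bd_orbit_def using G_comp[OF T wb g] by (metis comp_assoc imageI)
  qed
  have invariant: "U ?\<delta> (g \<circ> z) = U ?\<delta> z" if g: "g \<in> G" "g \<circ> x = x" and z: "z \<in> ?B" for g z
  proof -
    have "inv_into UNIV g \<circ> p = x \<longleftrightarrow> p = x" for p
      using inv_comp[OF g(1)] g(2) by metis
    \<comment> \<open>For \<open>p\<close> outside the orbit both sides vanish, because
      \<open>x\<close> lies in the orbit.\<close>
    then have "quasi_regular G x g ?\<delta> p = ?\<delta> p" for p
      using xA by (cases "p = x") (simp_all only: quasi_regular_def if_True if_False simp_thms if_cancel)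
    then have "quasi_regular G x g ?\<delta> = ?\<delta>" by (rule ext)
    then have "U ?\<delta> = quasi_regular G y g (U ?\<delta>)" using comm[OF g(1) \<delta>(1)] by (simp only:)
    \<comment> \<open>Evaluation at \<open>g \<circ> z\<close> cancels the inverse in
      \<open>quasi_regular\<close> and leaves the value at \<open>z\<close>.\<close>
    then have "U ?\<delta> (g \<circ> z) = quasi_regular G y g (U ?\<delta>) (g \<circ> z)" by (rule fun_cong)
    moreover have "g \<circ> z \<in> ?B"
      using orbit_closed[OF g(1) z] .
    ultimately show ?thesis
      by (simp only: quasi_regular_def inv_comp(1)[OF g(1)] if_True)
  qed
  have "U ?\<delta> z = 0" if z: "z \<in> ?B" for z
  proof (rule l2_zero_of_constant_on_infinite[OF \<eta>])
    let ?S = "(\<lambda>g. g \<circ> z) ` {g \<in> G. g \<circ> x = x}"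
    have "z \<in> boundary T"
      using z Aut_boundary[OF T G_Aut[OF T wb] assms(6)] by (auto simp only: bd_orbit_def)
    \<comment> \<open>Disjointness of the orbits enters here: the fixed point \<open>x\<close> of
      the stabilizer does not lie in the orbit of \<open>y\<close>.\<close>
    moreover have "z \<noteq> x" using z xA assms(7) by blast
    ultimately show "infinite ?S"
      using infinite_stabilizer_orbit[OF T wb assms(5)] by blast
    show "?S \<subseteq> ?B"
      using orbit_closed z by blast
    show "U ?\<delta> w = U ?\<delta> z" if "w \<in> ?S" for w
      using that invariant z by blast
  qed
  then have "l2_inner ?B (U ?\<delta>) (U ?\<delta>) = 0"
    unfolding l2_inner_def by (intro infsum_0) simp
  \<comment> \<open>Unitarity forces the same inner product to be that of \<open>?\<delta>\<close>
    with itself, which is 1.\<close>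
  then show False using U \<delta> by (simp add: unitary_map_def)
qed

end
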